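(* Let $V$ be a valuation domain of rank one with quotient field $K$ and value group $\Gamma_v\subseteq\mathbb{R}$. Let $\beta\in K$, and let $\mathcal{V}_{\mathrm{div}}(\beta,\bullet)=\{V_E\mid E\text{ is a pseudo-divergent sequence in }K\text{ with }\beta\in\mathcal{L}_E\}$. Then, with respect to the Zariski topology on the first two spaces, there are homeomorphisms $$\mathcal{V}_{\mathrm{div}}(\beta,\bullet)\simeq\mathcal{V}(\beta,\bullet)\simeq(-\infty,+\infty]_{\mathbb{Q}\Gamma_v}.$$
   Context: $\mathrm{Zar}(K(X)|V)$ is the set of valuation domains of $K(X)$ (with quotient field $K(X)$) containing $V$; its Zariski topology is generated by the subbasic open sets $B(\phi)=\{W\mid\phi\in W\}$, $\phi\in K(X)$; subsets carry the subspace topology. $v$ is the valuation associated to $V$; $\mathbb{Q}\Gamma_v=\{q\gamma\mid q\in\mathbb{Q},\gamma\in\Gamma_v\}$. A sequence $E=\{s_n\}_{n\in\mathbb{N}}$ in $K$ is pseudo-convergent if $v(s_{n+1}-s_n)<v(s_{n+2}-s_{n+1})$ for all $n$, and pseudo-divergent if $v(s_n-s_{n+1})>v(s_{n+1}-s_{n+2})$ for all $n$. In both cases $V_E=\{\phi\in K(X)\mid\phi(s_n)\in V\text{ for all but finitely many }n\in\mathbb{N}\}$ is a valuation domain of $K(X)$ extending $V$. The set $\mathcal{L}_E\subseteq K$ of pseudo-limits of $E$ is: if $E$ is pseudo-convergent, the set of $\alpha\in K$ with $v(\alpha-s_n)<v(\alpha-s_{n+1})$ for all $n$; if $E$ is pseudo-divergent,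 the set of $\alpha\in K$ such that $v(\alpha-s_n)$ is eventually strictly decreasing (equivalently, $\mathcal{L}_E=\{x\in K\mid v(x-s_0)>\delta_E\}$, where $\delta_E=\lim_{n\to\infty}v(s_{n+1}-s_n)\in\mathbb{R}\cup\{-\infty\}$). $\mathcal{V}(\beta,\bullet)$ is the set of rings $V_E$ with $E$ a pseudo-convergent sequence in $K$ such that $\beta\in\mathcal{L}_E$. $(-\infty,+\infty]_{\mathbb{Q}\Gamma_v}$ is the set $(-\infty,+\infty]=\mathbb{R}\cup\{+\infty\}$ with the topology generated by the sets $(\alpha,\lambda]$, for $\lambda\in\mathbb{Q}\Gamma_v\cup\{\infty\}$ and $\alpha\in(-\infty,+\infty]$.
   Formalization: The second homeomorphism, of V(β,•) with (−∞,+∞], is stated only for V not discrete (value group not cyclic); for a discrete V it is false, since V(β,•) is then a single point. The first homeomorphism is stated for every rank-one V. *)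

theory Defs
  imports "HOL-Analysis.Analysis" "HOL-Computational_Algebra.Computational_Algebra"
begin

section \<open>Valuation domains\<close>

text \<open>
  The ambient field is a type; a valuation domain is a subset of it, whose quotient field is
  required to be the whole type (this is forced by the last clause).
\<close>

definition valuation_domain :: "'a::field set \<Rightarrow> bool" where
  "valuation_domain W \<longleftrightarrow>
     1 \<in> W \<and> (\<forall>x\<in>W. \<forall>y\<in>W. x - y \<in> W \<and> x * y \<in> W) \<and>
     (\<forall>x. x \<noteq> 0 \<longrightarrow> x \<in> W \<or> inverse x \<in> W)"

definition prime_ideal_of :: "'a::field set \<Rightarrow> 'a set \<Rightarrow> bool" where
  "prime_ideal_of W P \<longleftrightarrow>
     P \<subseteq> W \<and> P \<noteq> W \<and> 0 \<in> P \<and>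
     (\<forall>x\<in>P. \<forall>y\<in>P. x + y \<in> P) \<and> (\<forall>a\<in>W. \<forall>x\<in>P. a * x \<in> P) \<and>
     (\<forall>x\<in>W. \<forall>y\<in>W. x * y \<in> P \<longrightarrow> x \<in> P \<or> y \<in> P)"

text \<open>The rank of a valuation domain is its Krull dimension.\<close>

definition rank_one :: "'a::field set \<Rightarrow> bool" where
  "rank_one W \<longleftrightarrow>
     (\<exists>P Q. prime_ideal_of W P \<and> prime_ideal_of W Q \<and> P \<subset> Q) \<and>
     \<not> (\<exists>P Q R. prime_ideal_of W P \<and> prime_ideal_of W Q \<and> prime_ideal_of W R \<and> P \<subset> Q \<and> Q \<subset> R)"

definition real_valuation :: "('a::field \<Rightarrow> ereal) \<Rightarrow> bool" where
  "real_valuation v \<longleftrightarrow>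
     (\<forall>x. v x = \<infinity> \<longleftrightarrow> x = 0) \<and> (\<forall>x. v x \<noteq> -\<infinity>) \<and>
     (\<forall>x y. v (x * y) = v x + v y) \<and>
     (\<forall>x y. min (v x) (v y) \<le> v (x + y))"

definition associated_valuation :: "'a::field set \<Rightarrow> ('a \<Rightarrow> ereal) \<Rightarrow> bool" where
  "associated_valuation V v \<longleftrightarrow> real_valuation v \<and> V = {x. 0 \<le> v x}"

definition value_group :: "('a::field \<Rightarrow> ereal) \<Rightarrow> real set" where
  "value_group v = {g. \<exists>x. v x = ereal g}"

definition rational_span_value_group :: "('a::field \<Rightarrow> ereal) \<Rightarrow> real set" where
  "rational_span_value_group v = {of_rat q * g | q g. g \<in> value_group v}"

text \<open>
  For a discrete \<open>V\<close> of rank one, every pseudo-convergent sequence with pseudo-limit \<open>\<beta>\<close> converges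
  to \<open>\<beta>\<close> and all of them define the same ring, so the space of these rings is a single point and
  cannot be homeomorphic to the half-open line.
\<close>

definition discrete_valuation :: "('a::field \<Rightarrow> ereal) \<Rightarrow> bool" where
  "discrete_valuation v \<longleftrightarrow> (\<exists>g. value_group v = {of_int n * g | n. True})"


section \<open>The Zariski space of \<open>K(X)\<close> over \<open>V\<close>\<close>

definition const_rf :: "'k::field \<Rightarrow> 'k poly fract" where
  "const_rf c = Fraction_Field.Fract [:c:] 1"

definition Zar :: "'k::field set \<Rightarrow> 'k poly fract set set" where
  "Zar V = {W. valuation_domain W \<and> const_rf ` V \<subseteq> W}"

definition Zariski_topology :: "'k::field set \<Rightarrow> 'k poly fract set topology" where
  "Zariski_topology V = topology_generated_by {{W \<in> Zar V. \<phi> \<in> W} | \<phi>. True}"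


section \<open>Pseudo-convergent and pseudo-divergent sequences\<close>

definition pseudo_convergent :: "('k::field \<Rightarrow> ereal) \<Rightarrow> (nat \<Rightarrow> 'k) \<Rightarrow> bool" where
  "pseudo_convergent v s \<longleftrightarrow> (\<forall>n. v (s (n+1) - s n) < v (s (n+2) - s (n+1)))"

definition pseudo_divergent :: "('k::field \<Rightarrow> ereal) \<Rightarrow> (nat \<Rightarrow> 'k) \<Rightarrow> bool" where
  "pseudo_divergent v s \<longleftrightarrow> (\<forall>n. v (s n - s (n+1)) > v (s (n+1) - s (n+2)))"

definition pseudo_limits_conv :: "('k::field \<Rightarrow> ereal) \<Rightarrow> (nat \<Rightarrow> 'k) \<Rightarrow> 'k set" where
  "pseudo_limits_conv v s = {\<alpha>. \<forall>n. v (\<alpha> - s n) < v (\<alpha> - s (n+1))}"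

definition pseudo_limits_div :: "('k::field \<Rightarrow> ereal) \<Rightarrow> (nat \<Rightarrow> 'k) \<Rightarrow> 'k set" where
  "pseudo_limits_div v s = {\<alpha>. \<exists>N. \<forall>n\<ge>N. v (\<alpha> - s n) > v (\<alpha> - s (n+1))}"

text \<open>
  \<open>rf_value \<phi> a y\<close>: the rational function \<open>\<phi>\<close> is defined at \<open>a\<close>, with value \<open>y\<close>.  Quantifying over
  all representations as a quotient makes this independent of common factors.
\<close>

definition rf_value :: "'k::field poly fract \<Rightarrow> 'k \<Rightarrow> 'k \<Rightarrow> bool" where
  "rf_value \<phi> a y \<longleftrightarrow>
     (\<exists>p q. \<phi> = Fraction_Field.Fract p q \<and> poly q a \<noteq> 0 \<and> y = poly p a / poly q a)"

definition V_seq :: "'k::field set \<Rightarrow> (nat \<Rightarrow> 'k) \<Rightarrow> 'k poly fract set" where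
  "V_seq V s = {\<phi>. finite {n. \<not> (\<exists>y\<in>V. rf_value \<phi> (s n) y)}}"

definition V_conv :: "'k::field set \<Rightarrow> ('k \<Rightarrow> ereal) \<Rightarrow> 'k \<Rightarrow> 'k poly fract set set" where
  "V_conv V v \<beta> = {V_seq V s | s. pseudo_convergent v s \<and> \<beta> \<in> pseudo_limits_conv v s}"

definition V_div :: "'k::field set \<Rightarrow> ('k \<Rightarrow> ereal) \<Rightarrow> 'k \<Rightarrow> 'k poly fract set set" where
  "V_div V v \<beta> = {V_seq V s | s. pseudo_divergent v s \<and> \<beta> \<in> pseudo_limits_div v s}"


section \<open>The half-open line\<close>

text \<open>The underlying set is \<open>{-\<infinity><..}\<close>, since \<open>\<lambda> = \<infinity>\<close> is allowed and \<open>\<alpha> = -\<infinity>\<close> is not.\<close>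

definition upper_line_topology :: "real set \<Rightarrow> ereal topology" where
  "upper_line_topology L =
     topology_generated_by {{\<alpha><..l} | \<alpha> l. -\<infinity> < \<alpha> \<and> l \<in> ereal ` L \<union> {\<infinity>}}"

end

(*
  Expand a polynomial in powers of X - beta.  Unless v(s - beta) is one of finitely many
  breakpoints, all of them in the divisible hull of the value group, a single term of the expansion
  at s has minimal value.  So for a rational function phi, whether phi(s) lies in V depends only on
  the position of v(s - beta) relative to finitely many breakpoints.

  Hence V_E only depends on the one-sided limit delta of v(s_n - beta), from the left for
  pseudo-convergent and from the right for pseudo-divergent sequences.  If b and c are consecutive
  breakpoints of phi, membership of phi in the ring of delta is constant on b < delta <= c, which is
  a basic open set of the half-open line.  Conversely, (X - beta)/c and c/(X - beta)^k cut out the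
  basic open sets; separating different values of delta needs the value group to be dense.

  The substitution X - beta -> 1/(X - beta) exchanges the two kinds of sequences and gives the first
  homeomorphism, without any density assumption.
*)

theory Submission
  imports Defs
begin

section \<open>Finite families of lines\<close>

text \<open>Both inequalities are strict, so the relation also keeps \<open>x\<close> and
  \<open>y\<close> off \<open>B\<close>; it fails for \<open>x = y\<close> at a point of
  \<open>B\<close>.\<close>

definition same_side :: "real set \<Rightarrow> real \<Rightarrow> real \<Rightarrow> bool" where
  "same_side B x y \<longleftrightarrow> (\<forall>b\<in>B. x < b \<and> y < b \<or> b < x \<and> b < y)"

text \<open>A pair \<open>(i, g)\<close> encodes the line \<open>g + i x\<close>.\<close>

definition line_value :: "real \<times> real \<Rightarrow> real \<Rightarrow> real" where
  "line_value l x = snd l + fst l * x"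

text \<open>The abscissae at which two non-parallel lines of \<open>L\<close> meet; they include
  every breakpoint of the minimum of the lines.\<close>

definition crossings :: "(real \<times> real) set \<Rightarrow> real set" where
  "crossings L = (\<lambda>(l, m). (snd l - snd m) / (fst m - fst l)) ` {(l, m) \<in> L \<times> L. fst l \<noteq> fst m}"

lemma finite_crossings: "finite L \<Longrightarrow> finite (crossings L)"
  unfolding crossings_def by (rule finite_imageI, rule finite_subset[of _ "L \<times> L"]) auto

lemma crossingsI:
  assumes "l \<in> L" "m \<in> L" "fst l \<noteq> fst m"
  shows "(snd l - snd m) / (fst m - fst l) \<in> crossings L"
  unfolding crossings_def using assms by force

lemma line_value_eq_imp_crossing:
  assumes "l \<in> L" "m \<in> L" "fst l \<noteq> fst m" "line_value l x = line_value m x"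
  shows "x \<in> crossings L"
proof -
  have "x = (snd l - snd m) / (fst m - fst l)"
    using assms(3,4) by (simp add: line_value_def field_simps)
  then show ?thesis using crossingsI[OF assms(1-3)] by simp
qed

text \<open>The difference of two lines is constant or changes sign only where they cross.\<close>

lemma line_order_same_side:
  assumes "l \<in> L" "m \<in> L" "same_side (crossings L) x y"
  shows "line_value l x \<le> line_value m x \<longleftrightarrow> line_value l y \<le> line_value m y"
proof (cases "fst l" "fst m" rule: linorder_cases)
  case equal
  then show ?thesis by (simp add: line_value_def)
next
  case less
  define b where "b = (snd l - snd m) / (fst m - fst l)"
  have *: "line_value l z \<le> line_value m z \<longleftrightarrow> b \<le> z" for z
    using less by (simp add: line_value_def b_def field_simps)
  have "b \<in> crossings L" using crossingsI assms less b_def by auto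
  then show ?thesis using assms(3) unfolding * same_side_def by force
next
  case greater
  define b where "b = (snd l - snd m) / (fst m - fst l)"
  have *: "line_value l z \<le> line_value m z \<longleftrightarrow> z \<le> b" for z
    using greater by (simp add: line_value_def b_def field_simps)
  have "b \<in> crossings L" using crossingsI assms greater b_def by auto
  then show ?thesis using assms(3) unfolding * same_side_def by force
qed

section \<open>Values of polynomials and rational functions\<close>

locale valued_field =
  fixes v :: "'k::field \<Rightarrow> ereal"
  assumes real_valuation: "real_valuation v"
begin

abbreviation "R \<equiv> {x. 0 \<le> v x}"

definition regular :: "'k poly fract \<Rightarrow> 'k \<Rightarrow> bool" where
  "regular \<phi> s \<longleftrightarrow> (\<exists>y\<in>R. rf_value \<phi> s y)"

section \<open>Arithmetic of the valuation\<close>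

lemma v_eq_infinity [simp]: "v x = \<infinity> \<longleftrightarrow> x = 0"
  and v_neq_minus_infinity [simp]: "v x \<noteq> -\<infinity>"
  and v_mult: "v (x * y) = v x + v y"
  and v_add: "min (v x) (v y) \<le> v (x + y)"
  using real_valuation unfolding real_valuation_def by blast+

lemma v_zero [simp]: "v 0 = \<infinity>" by simp

lemma v_realE:
  assumes "x \<noteq> 0"
  obtains g where "v x = ereal g"
  using assms by (cases "v x") (auto simp: v_eq_infinity[symmetric] simp del: v_eq_infinity)

lemma v_one [simp]: "v 1 = 0"
proof -
  obtain g where "v 1 = ereal g" using v_realE[of 1] by auto
  with v_mult[of 1 1] show ?thesis by simp
qed

lemma v_minus [simp]: "v (- x) = v x"
proof -
  obtain g where g: "v (-1) = ereal g" using v_realE[of "-1"] by auto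
  with v_mult[of "-1" "-1"] have "v (-1) = 0" by simp
  with v_mult[of "-1" x] show ?thesis by simp
qed

lemma v_minus_commute: "v (x - y) = v (y - x)"
  using v_minus[of "x - y"] by simp

lemma v_inverse:
  assumes "v x = ereal g" shows "v (inverse x) = ereal (- g)"
proof -
  have "x \<noteq> 0" using assms by auto
  then obtain h where h: "v (inverse x) = ereal h" using v_realE[of "inverse x"] by auto
  have "v (x * inverse x) = 0" using \<open>x \<noteq> 0\<close> by simp
  then show ?thesis using assms h by (simp add: v_mult)
qed

lemma v_power:
  assumes "v x = ereal g" shows "v (x ^ n) = ereal (n * g)"
  by (induction n) (simp_all add: v_mult assms algebra_simps zero_ereal_def)

lemma v_add_eq: 
  assumes "v x < v y" shows "v (x + y) = v x"
proof -
  have "min (v (x + y)) (v (- y)) \<le> v x" using v_add[of "x + y" "- y"] by simp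
  moreover have "v x \<le> v (x + y)" using v_add[of x y] assms by (simp add: min_absorb1)
  ultimately show ?thesis using assms by (auto simp: min_def split: if_splits)
qed

text \<open>The bound \<open>c < \<infinity>\<close> covers the empty sum and, since
  \<open>sum\<close> is 0 on infinite sets, an infinite \<open>S\<close>.\<close>

lemma v_sum_gt:
  assumes "\<And>i. i \<in> S \<Longrightarrow> c < v (t i)" "c < \<infinity>"
  shows "c < v (sum t S)"
proof (cases "finite S")
  case True
  then show ?thesis using assms(1)
  proof (induction S)
    case empty
    then show ?case using assms(2) by simp
  next
    case (insert i S)
    then have "c < min (v (t i)) (v (sum t S))" by simp
    also have "\<dots> \<le> v (sum t (insert i S))" using insert v_add by simp
    finally show ?case .
  qed
qed (use assms in simp)

lemma v_sum_dominant:
  assumes "finite S" "k \<in> S" "t k \<noteq> 0" "\<And>i. i \<in> S \<Longrightarrow> i \<noteq> k \<Longrightarrow> v (t k) < v (t i)"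
  shows "v (sum t S) = v (t k)"
proof -
  have "v (t k) < v (sum t (S - {k}))"
    by (rule v_sum_gt) (use assms in auto)
  then have "v (t k + sum t (S - {k})) = v (t k)" by (rule v_add_eq)
  then show ?thesis using assms by (simp add: sum.remove)
qed

text \<open>The tropical polynomial of \<open>p\<close>: a coefficient \<open>a\<close> of degree
  \<open>i\<close> gives the line \<open>v a + i x\<close>, the value of its term at an argument of
  value \<open>x\<close>. Zero coefficients give no line, so \<open>real_of_ereal\<close> never
  meets \<infinity>.\<close>

definition lines :: "'k poly \<Rightarrow> (real \<times> real) set" where
  "lines p = (\<lambda>i. (real i, real_of_ereal (v (coeff p i)))) ` {i. coeff p i \<noteq> 0}"

lemma finite_lines: "finite (lines p)"
  unfolding lines_def by (simp add: MOST_coeff_eq_0[unfolded MOST_iff_cofinite])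

text \<open>Off the crossings, terms of different degree have different values, so the least one
  determines the value of the sum. A larger \<open>L\<close> is allowed so that numerator and
  denominator can share their crossings.\<close>

lemma v_poly:
  assumes "p \<noteq> 0" "lines p \<subseteq> L" "\<gamma> \<notin> crossings L" "v x = ereal \<gamma>"
  shows "\<exists>l\<in>lines p. v (poly p x) = ereal (line_value l \<gamma>) \<and>
           (\<forall>m\<in>lines p. line_value l \<gamma> \<le> line_value m \<gamma>)"
proof -
  define I where "I = {i. coeff p i \<noteq> 0}"
  define f where "f i = (real i, real_of_ereal (v (coeff p i)))" for i
  have lp: "lines p = f ` I" by (simp add: lines_def f_def I_def)
  have fin: "finite I" unfolding I_def by (simp add: MOST_coeff_eq_0[unfolded MOST_iff_cofinite])
  have ne: "I \<noteq> {}" unfolding I_def using assms(1) leading_coeff_0_iff by blast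
  have x0: "x \<noteq> 0" using assms(4) by auto
  define k where "k = arg_min_on (\<lambda>i. line_value (f i) \<gamma>) I"
  have k: "k \<in> I" unfolding k_def by (rule arg_min_if_finite[OF fin ne])
  have min: "line_value (f k) \<gamma> \<le> line_value (f i) \<gamma>" if "i \<in> I" for i
    unfolding k_def by (rule arg_min_least[OF fin ne that])
  have tm: "v (coeff p i * x ^ i) = ereal (line_value (f i) \<gamma>)" if "i \<in> I" for i
  proof -
    have "coeff p i \<noteq> 0" using that by (simp add: I_def)
    then obtain g where "v (coeff p i) = ereal g" by (rule v_realE)
    then show ?thesis by (simp add: v_mult v_power[OF assms(4)] line_value_def f_def)
  qed
  have "poly p x = (\<Sum>i\<in>I. coeff p i * x ^ i)"
    unfolding poly_altdef I_def
    by (rule sum.mono_neutral_right) (auto intro: le_degree)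
  also have "v \<dots> = v (coeff p k * x ^ k)"
  proof (rule v_sum_dominant[OF fin k])
    show "coeff p k * x ^ k \<noteq> 0" using k x0 by (simp add: I_def)
    fix i assume i: "i \<in> I" "i \<noteq> k"
    \<comment> \<open>Different degrees are different slopes, so a tie at \<gamma> would be a
      crossing.\<close>
    have "line_value (f k) \<gamma> \<noteq> line_value (f i) \<gamma>"
      using line_value_eq_imp_crossing[of "f k" L "f i" \<gamma>] assms(2,3) k i
      unfolding lp by (auto simp: f_def)
    with min[OF i(1)] show "v (coeff p k * x ^ k) < v (coeff p i * x ^ i)"
      using k i by (simp add: tm)
  qed
  finally show ?thesis unfolding lp using k min tm by auto
qed

text \<open>The right-hand side only compares lines, so \<open>line_order_same_side\<close> can
  transport it. For \<open>p = 0\<close> it holds because \<open>lines p\<close> is empty and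
  \<open>lines q\<close> is not.\<close>

lemma v_poly_le_iff:
  assumes "q \<noteq> 0" "lines p \<subseteq> L" "lines q \<subseteq> L" "\<gamma> \<notin> crossings L" "v x = ereal \<gamma>"
  shows "v (poly q x) \<le> v (poly p x) \<longleftrightarrow>
           (\<exists>m\<in>lines q. \<forall>l\<in>lines p. line_value m \<gamma> \<le> line_value l \<gamma>)"
proof -
  obtain m where m: "m \<in> lines q" "v (poly q x) = ereal (line_value m \<gamma>)"
    "\<forall>l\<in>lines q. line_value m \<gamma> \<le> line_value l \<gamma>"
    using v_poly[OF assms(1,3,4,5)] by blast
  show ?thesis
  proof (cases "p = 0")
    case True
    then have "lines p = {}" by (simp add: lines_def)
    then show ?thesis using True m(1) by (simp del: split_paired_Ex) blast
  next
    case False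
    from v_poly[OF this assms(2,4,5)] obtain l where "l \<in> lines p" "v (poly p x) = ereal (line_value l \<gamma>)"
      "\<forall>m\<in>lines p. line_value l \<gamma> \<le> line_value m \<gamma>" by blast
    then show ?thesis using m by (auto intro: order.trans)
  qed
qed

section \<open>Values of rational functions\<close>

lemma rf_value_Fract:
  assumes "poly q s \<noteq> 0"
  shows "rf_value (Fraction_Field.Fract p q) s y \<longleftrightarrow> y = poly p s / poly q s"
proof
  assume "rf_value (Fraction_Field.Fract p q) s y"
  then obtain p' q' where *: "Fraction_Field.Fract p q = Fraction_Field.Fract p' q'"
    "poly q' s \<noteq> 0" "y = poly p' s / poly q' s" unfolding rf_value_def by blast
  have "q \<noteq> 0" "q' \<noteq> 0" using * assms by auto
  with *(1) have "p * q' = p' * q" by (simp add: eq_fract)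
  then have "poly p s * poly q' s = poly p' s * poly q s" by (metis poly_mult)
  then show "y = poly p s / poly q s" using *(2,3) assms by (simp add: frac_eq_eq)
qed (use assms in \<open>auto simp: rf_value_def\<close>)

lemma regular_Fract:
  assumes "poly q s \<noteq> 0"
  shows "regular (Fraction_Field.Fract p q) s \<longleftrightarrow> v (poly q s) \<le> v (poly p s)"
proof -
  obtain g where g: "v (poly q s) = ereal g" using v_realE[OF assms] .
  have "v (poly p s) = v (poly p s / poly q s) + ereal g"
    using v_mult[of "poly p s / poly q s" "poly q s"] assms g by simp
  then show ?thesis using g
    by (cases "v (poly p s / poly q s)") (auto simp: regular_def rf_value_Fract[OF assms])
qed

section \<open>The value group and the location of breakpoints\<close>

lemma value_group_minus: "g \<in> value_group v \<Longrightarrow> - g \<in> value_group v"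
  unfolding value_group_def using v_inverse by blast

lemma value_group_add: "g \<in> value_group v \<Longrightarrow> h \<in> value_group v \<Longrightarrow> g + h \<in> value_group v"
  unfolding value_group_def mem_Collect_eq by (metis v_mult plus_ereal.simps(1))

lemma value_group_diff: "g \<in> value_group v \<Longrightarrow> h \<in> value_group v \<Longrightarrow> g - h \<in> value_group v"
  using value_group_add[OF _ value_group_minus] by fastforce

lemma value_group_zero: "0 \<in> value_group v"
  unfolding value_group_def using v_one unfolding zero_ereal_def by blast

lemma lines_in_value_group:
  assumes "l \<in> lines p" shows "fst l \<in> \<rat>" "snd l \<in> value_group v"
proof -
  obtain i where i: "l = (real i, real_of_ereal (v (coeff p i)))" "coeff p i \<noteq> 0"
    using assms unfolding lines_def by blast
  obtain g where "v (coeff p i) = ereal g" using v_realE[OF i(2)] .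
  then show "fst l \<in> \<rat>" "snd l \<in> value_group v" using i(1) by (auto simp: value_group_def)
qed

text \<open>A crossing is a difference of intercepts, which lies in the value group, divided by a
  difference of slopes, which is rational.\<close>

lemma crossings_subset_rational_span:
  assumes "\<And>l. l \<in> L \<Longrightarrow> fst l \<in> \<rat>" "\<And>l. l \<in> L \<Longrightarrow> snd l \<in> value_group v"
  shows "crossings L \<subseteq> rational_span_value_group v"
proof
  fix b assume "b \<in> crossings L"
  then obtain l m where lm: "l \<in> L" "m \<in> L" "b = (snd l - snd m) / (fst m - fst l)"
    unfolding crossings_def by auto
  have "inverse (fst m - fst l) \<in> \<rat>" using assms(1) lm(1,2) by simp
  then obtain r where "inverse (fst m - fst l) = of_rat r" by (rule Rats_cases)
  then have "b = of_rat r * (snd l - snd m)" using lm(3) by (simp add: divide_inverse)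
  moreover have "snd l - snd m \<in> value_group v" using assms(2) lm(1,2) by (simp add: value_group_diff)
  ultimately show "b \<in> rational_span_value_group v"
    unfolding rational_span_value_group_def by blast
qed

text \<open>\<open>B\<close> consists of the crossings of all lines of numerator and denominator,
  both expanded around \<beta>. Between consecutive crossings the order of the lines, and with it
  regularity, cannot change.\<close>

lemma regular_same_side:
  "\<exists>B. finite B \<and> B \<subseteq> rational_span_value_group v \<and>
     (\<forall>s t x y. v (s - \<beta>) = ereal x \<longrightarrow> v (t - \<beta>) = ereal y \<longrightarrow> same_side B x y \<longrightarrow>
        regular \<phi> s = regular \<phi> t)"
proof -
  obtain p q where \<phi>: "\<phi> = Fraction_Field.Fract p q" "q \<noteq> 0"
    by (cases \<phi>) auto
  define p' q' where "p' = p \<circ>\<^sub>p [:\<beta>, 1:]" and "q' = q \<circ>\<^sub>p [:\<beta>, 1:]"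
  define L where "L = lines p' \<union> lines q'"
  have pq: "poly p' (s - \<beta>) = poly p s" "poly q' (s - \<beta>) = poly q s" for s
    by (simp_all add: p'_def q'_def poly_pcompose)
  have q': "q' \<noteq> 0" using \<phi>(2) unfolding q'_def by (subst pcompose_eq_0_iff) auto
  have L: "lines p' \<subseteq> L" "lines q' \<subseteq> L" by (auto simp: L_def)
  have reg: "regular \<phi> s \<longleftrightarrow> (\<exists>m\<in>lines q'. \<forall>l\<in>lines p'. line_value m x \<le> line_value l x)"
    if "v (s - \<beta>) = ereal x" "x \<notin> crossings L" for s x
  proof -
    \<comment> \<open>Off the crossings \<open>v_poly\<close> gives the denominator a finite value,
      so it cannot vanish.\<close>
    have "poly q s \<noteq> 0"
    proof
      assume "poly q s = 0"
      then have "v (poly q' (s - \<beta>)) = \<infinity>" by (simp add: pq)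
      with v_poly[OF q' L(2) that(2,1)] show False by auto
    qed
    then show ?thesis
      using v_poly_le_iff[OF q' L that(2,1)] by (simp add: \<phi> regular_Fract pq)
  qed
  show ?thesis
  proof (intro exI conjI allI impI)
    show "finite (crossings L)" unfolding L_def by (simp add: finite_crossings finite_lines)
    show "crossings L \<subseteq> rational_span_value_group v"
      by (rule crossings_subset_rational_span) (auto simp: L_def dest: lines_in_value_group)
    fix s t x y assume *: "v (s - \<beta>) = ereal x" "v (t - \<beta>) = ereal y" "same_side (crossings L) x y"
    then have "x \<notin> crossings L" "y \<notin> crossings L" by (auto simp: same_side_def)
    moreover have "line_value m x \<le> line_value l x \<longleftrightarrow> line_value m y \<le> line_value l y"
      if "m \<in> lines q'" "l \<in> lines p'" for l m
      using line_order_same_side[OF _ _ *(3)] L that by blast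
    ultimately show "regular \<phi> s = regular \<phi> t"
      by (simp add: reg[OF *(1)] reg[OF *(2)])
  qed
qed

lemma V_seq_iff: "\<phi> \<in> V_seq R s \<longleftrightarrow> (\<forall>\<^sub>F n in sequentially. regular \<phi> (s n))"
  by (simp add: V_seq_def regular_def cofinite_eq_sequentially[symmetric] eventually_cofinite)

end

section \<open>The rings of pseudo-convergent and pseudo-divergent sequences\<close>

text \<open>
  Covers strictly increasing and strictly decreasing sequences alike.  The case \<open>b = \<infinity>\<close> makes
  the values eventually finite.
\<close>

definition settles :: "(nat \<Rightarrow> ereal) \<Rightarrow> bool" where
  "settles f \<longleftrightarrow> (\<forall>b. (\<forall>\<^sub>F n in sequentially. f n < b) \<or> (\<forall>\<^sub>F n in sequentially. b < f n))"

section \<open>Settling sequences of values\<close>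

lemma settles_increasing:
  assumes "\<And>n. f n < f (Suc n)"
  shows "settles f"
  unfolding settles_def
proof (intro allI)
  fix b
  have mono: "strict_mono f" using assms by (simp add: strict_mono_Suc_iff)
  show "(\<forall>\<^sub>F n in sequentially. f n < b) \<or> (\<forall>\<^sub>F n in sequentially. b < f n)"
  proof (cases "\<exists>N. b \<le> f N")
    case True
    then obtain N where "b \<le> f N" by blast
    then have "b < f n" if "n \<ge> Suc N" for n
      using strict_monoD[OF mono, of N n] that by (meson Suc_le_lessD le_less_trans)
    then show ?thesis unfolding eventually_sequentially by blast
  qed (auto simp: not_le)
qed

lemma settles_uminus:
  assumes "settles (\<lambda>n. - f n)" shows "settles f"
  unfolding settles_def
proof
  fix b
  show "(\<forall>\<^sub>F n in sequentially. f n < b) \<or> (\<forall>\<^sub>F n in sequentially. b < f n)"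
    using assms[unfolded settles_def, rule_format, of "- b"] by auto
qed

lemma settles_decreasing:
  assumes "\<And>n. f (Suc n) < f n"
  shows "settles f"
  by (rule settles_uminus, rule settles_increasing) (simp add: assms)

lemma settles_cong:
  assumes "\<forall>\<^sub>F n in sequentially. f n = g n" "settles g"
  shows "settles f"
  unfolding settles_def
proof
  fix b
  consider "\<forall>\<^sub>F n in sequentially. g n < b" | "\<forall>\<^sub>F n in sequentially. b < g n"
    using assms(2) unfolding settles_def by blast
  then show "(\<forall>\<^sub>F n in sequentially. f n < b) \<or> (\<forall>\<^sub>F n in sequentially. b < f n)"
  proof cases
    case 1
    with assms(1) have "\<forall>\<^sub>F n in sequentially. f n < b" by eventually_elim simp
    then show ?thesis ..
  next
    case 2
    with assms(1) have "\<forall>\<^sub>F n in sequentially. b < f n" by eventually_elim simp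
    then show ?thesis ..
  qed
qed

lemma settles_neq:
  assumes "settles f" shows "\<forall>\<^sub>F n in sequentially. f n \<noteq> b"
proof -
  consider "\<forall>\<^sub>F n in sequentially. f n < b" | "\<forall>\<^sub>F n in sequentially. b < f n"
    using assms unfolding settles_def by blast
  then show ?thesis by cases (auto elim!: eventually_mono)
qed

locale centered_valued_field = valued_field v for v :: "'k::field \<Rightarrow> ereal" +
  fixes \<beta> :: 'k
begin

text \<open>One notion for both kinds of sequences: values at \<beta> that strictly increase or
  strictly decrease settle, and settling survives the inversion below.\<close>

definition settling :: "(nat \<Rightarrow> 'k) \<Rightarrow> bool" where
  "settling s \<longleftrightarrow> settles (\<lambda>n. v (s n - \<beta>))"

lemma eventually_neq:
  assumes "settling s" shows "\<forall>\<^sub>F n in sequentially. s n \<noteq> r"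
  using settles_neq[OF assms[unfolded settling_def], of "v (r - \<beta>)"] by (auto elim!: eventually_mono)

lemma eventually_poly_neq_0:
  assumes "settling s" "q \<noteq> 0"
  shows "\<forall>\<^sub>F n in sequentially. poly q (s n) \<noteq> 0"
proof -
  have "\<forall>\<^sub>F n in sequentially. \<forall>r\<in>{r. poly q r = 0}. s n \<noteq> r"
    using poly_roots_finite[OF assms(2)] eventually_neq[OF assms(1)] by (intro eventually_ball_finite) auto
  then show ?thesis by (auto elim!: eventually_mono)
qed

text \<open>Eventually the values stay on one side of each of the finitely many breakpoints, and
  there regularity is constant.\<close>

lemma regular_decided:
  assumes "settling s"
  shows "(\<forall>\<^sub>F n in sequentially. regular \<phi> (s n)) \<or> (\<forall>\<^sub>F n in sequentially. \<not> regular \<phi> (s n))"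
proof -
  define \<gamma> where "\<gamma> n = v (s n - \<beta>)" for n
  have set: "settles \<gamma>" using assms by (simp add: settling_def \<gamma>_def[abs_def])
  obtain B where B: "finite B"
    "\<And>s t x y. v (s - \<beta>) = ereal x \<Longrightarrow> v (t - \<beta>) = ereal y \<Longrightarrow> same_side B x y \<Longrightarrow>
        regular \<phi> s = regular \<phi> t"
    using regular_same_side[of \<beta> \<phi>] by blast
  define below where "below b \<longleftrightarrow> (\<forall>\<^sub>F n in sequentially. \<gamma> n < ereal b)" for b
  have "\<forall>\<^sub>F n in sequentially. if below b then \<gamma> n < ereal b else ereal b < \<gamma> n" for b
    using set[unfolded settles_def, rule_format, of "ereal b"] by (cases "below b") (auto simp: below_def)
  then have "\<forall>\<^sub>F n in sequentially. \<forall>b\<in>B. if below b then \<gamma> n < ereal b else ereal b < \<gamma> n"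
    using B(1) by (simp add: eventually_ball_finite)
  \<comment> \<open>Terms other than \<beta> have real values, as \<open>regular_same_side\<close>
    requires.\<close>
  with eventually_neq[OF assms, of \<beta>]
  have "\<forall>\<^sub>F n in sequentially. s n \<noteq> \<beta> \<and> (\<forall>b\<in>B. if below b then \<gamma> n < ereal b else ereal b < \<gamma> n)"
    by (rule eventually_conj)
  then obtain N where N: "\<And>n. n \<ge> N \<Longrightarrow> s n \<noteq> \<beta>"
    "\<And>n b. n \<ge> N \<Longrightarrow> b \<in> B \<Longrightarrow> if below b then \<gamma> n < ereal b else ereal b < \<gamma> n"
    unfolding eventually_sequentially by blast
  have "regular \<phi> (s n) \<longleftrightarrow> regular \<phi> (s N)" if n: "n \<ge> N" for n
  proof -
    obtain x where x: "v (s n - \<beta>) = ereal x" using v_realE[of "s n - \<beta>"] N(1)[OF n] by auto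
    obtain y where y: "v (s N - \<beta>) = ereal y" using v_realE[of "s N - \<beta>"] N(1)[of N] by auto
    have "same_side B x y"
      unfolding same_side_def
      using N(2)[OF n] N(2)[of N] x y unfolding \<gamma>_def by (force split: if_splits)
    with B(2) x y show ?thesis by blast
  qed
  then show ?thesis unfolding eventually_sequentially by (cases "regular \<phi> (s N)") auto
qed

lemma regular_const: "0 \<le> v c \<Longrightarrow> regular (const_rf c) s"
  unfolding const_rf_def by (simp add: regular_Fract)

lemma regular_diff_mult:
  assumes "regular \<phi> s" "regular \<psi> s"
  shows "regular (\<phi> - \<psi>) s" "regular (\<phi> * \<psi>) s"
proof -
  obtain p q y where p: "\<phi> = Fraction_Field.Fract p q" "poly q s \<noteq> 0" "y = poly p s / poly q s" "0 \<le> v y"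
    using assms unfolding regular_def rf_value_def by auto
  obtain p' q' z where p': "\<psi> = Fraction_Field.Fract p' q'" "poly q' s \<noteq> 0" "z = poly p' s / poly q' s" "0 \<le> v z"
    using assms unfolding regular_def rf_value_def by auto
  have "q \<noteq> 0" "q' \<noteq> 0" using p p' by auto
  have "rf_value (\<phi> - \<psi>) s (y - z)"
    unfolding rf_value_def using p p' \<open>q \<noteq> 0\<close> \<open>q' \<noteq> 0\<close>
    by (intro exI[of _ "p * q' - p' * q"] exI[of _ "q * q'"]) (simp add: diff_frac_eq)
  moreover have "rf_value (\<phi> * \<psi>) s (y * z)"
    unfolding rf_value_def using p p' by (intro exI[of _ "p * p'"] exI[of _ "q * q'"]) simp
  moreover have "0 \<le> v (y - z)" using v_add[of y "- z"] p(4) p'(4) by (simp add: min_def split: if_splits)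
  moreover have "0 \<le> v (y * z)" using p(4) p'(4) by (simp add: v_mult)
  ultimately show "regular (\<phi> - \<psi>) s" "regular (\<phi> * \<psi>) s" unfolding regular_def by auto
qed

text \<open>The inverse clause rests on \<open>regular_decided\<close>: a function outside the ring
  is eventually irregular, so its denominator has the larger value and its inverse is
  regular.\<close>

lemma V_seq_in_Zar:
  assumes "settling s" shows "V_seq R s \<in> Zar R"
proof -
  have "1 \<in> V_seq R s"
    using regular_const[of 1] by (simp add: V_seq_iff const_rf_def One_fract_def one_pCons)
  moreover have "x - y \<in> V_seq R s \<and> x * y \<in> V_seq R s" if "x \<in> V_seq R s" "y \<in> V_seq R s" for x y
    using that unfolding V_seq_iff by (auto elim: eventually_elim2 intro: regular_diff_mult)
  moreover have "inverse \<phi> \<in> V_seq R s" if "\<phi> \<noteq> 0" "\<phi> \<notin> V_seq R s" for \<phi>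
  proof -
    obtain p q where \<phi>: "\<phi> = Fraction_Field.Fract p q" "q \<noteq> 0" by (cases \<phi>) auto
    then have "p \<noteq> 0" using that(1) by (auto simp: Zero_fract_def eq_fract)
    have "\<forall>\<^sub>F n in sequentially. \<not> regular \<phi> (s n)"
      using that(2) regular_decided[OF assms] unfolding V_seq_iff by blast
    with eventually_poly_neq_0[OF assms \<open>p \<noteq> 0\<close>] eventually_poly_neq_0[OF assms \<open>q \<noteq> 0\<close>]
    show ?thesis unfolding V_seq_iff
    proof eventually_elim
      case (elim n)
      then show ?case by (simp add: \<phi> regular_Fract)
    qed
  qed
  moreover have "const_rf ` R \<subseteq> V_seq R s" by (auto simp: V_seq_iff regular_const)
  ultimately show ?thesis
    unfolding Zar_def valuation_domain_def mem_Collect_eq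
    by (intro conjI ballI allI impI) blast+
qed

section \<open>The substitution exchanging the two kinds of sequences\<close>

definition inversion :: "'k \<Rightarrow> 'k" where
  "inversion s = \<beta> + inverse (s - \<beta>)"

text \<open>This includes \<open>s = \<beta>\<close>, a fixed point because
  \<open>inverse 0 = 0\<close>.\<close>

lemma inversion_inversion [simp]: "inversion (inversion s) = s"
  by (simp add: inversion_def)

lemma v_inversion:
  assumes "s \<noteq> \<beta>" shows "v (inversion s - \<beta>) = - v (s - \<beta>)"
proof -
  obtain g where "v (s - \<beta>) = ereal g" using v_realE[of "s - \<beta>"] assms by auto
  then show ?thesis using v_inverse by (simp add: inversion_def)
qed

lemma settling_inversion:
  assumes "settling s" shows "settling (inversion \<circ> s)"
proof -
  have "settles (\<lambda>n. - v (s n - \<beta>))"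
    by (rule settles_uminus) (use assms in \<open>simp add: settling_def\<close>)
  moreover have "\<forall>\<^sub>F n in sequentially. v (inversion (s n) - \<beta>) = - v (s n - \<beta>)"
    using eventually_neq[OF assms, of \<beta>] by eventually_elim (rule v_inversion)
  ultimately show ?thesis unfolding settling_def comp_def by (rule settles_cong[rotated])
qed

text \<open>\<open>\<psi>\<close> is \<phi> after the substitution, with denominators cleared. It is
  chosen before \<open>s\<close>, so one function serves all settling sequences.\<close>

lemma regular_inversion:
  "\<exists>\<psi>. \<forall>s. settling s \<longrightarrow> (\<psi> \<in> V_seq R (inversion \<circ> s) \<longleftrightarrow> \<phi> \<in> V_seq R s)"
proof -
  obtain p q where \<phi>: "\<phi> = Fraction_Field.Fract p q" "q \<noteq> 0" by (cases \<phi>) auto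
  \<comment> \<open>Reverses the expansion of \<open>p\<close> around \<beta> and multiplies by the
    \<open>k\<close>-th power of \<open>X - \<beta>\<close>.\<close>
  define rev where "rev p k = (reflect_poly (p \<circ>\<^sub>p [:\<beta>, 1:]) * monom 1 k) \<circ>\<^sub>p [:-\<beta>, 1:]" for p :: "'k poly" and k
  have rev: "poly (rev p k) (inversion s) = inverse (s - \<beta>) ^ (degree p + k) * poly p s"
    if "s \<noteq> \<beta>" for p k s
    using that by (simp add: rev_def inversion_def poly_pcompose poly_reflect_poly_nz poly_monom power_add degree_pcompose)
  \<comment> \<open>Padding each polynomial by the degree of the other gives both the same factor
    \<open>c\<close> at inverted points, which cancels in the quotient.\<close>
  define p' q' where "p' = rev p (degree q)" and "q' = rev q (degree p)"
  show ?thesis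
  proof (intro exI allI impI)
    fix s assume s: "settling s"
    have "\<forall>\<^sub>F n in sequentially. regular (Fraction_Field.Fract p' q') ((inversion \<circ> s) n) \<longleftrightarrow> regular \<phi> (s n)"
      using eventually_poly_neq_0[OF s \<phi>(2)] eventually_neq[OF s, of \<beta>]
    proof eventually_elim
      case (elim n)
      define c where "c = inverse (s n - \<beta>) ^ (degree p + degree q)"
      have "c \<noteq> 0" using elim by (simp add: c_def)
      then obtain g where g: "v c = ereal g" using v_realE by blast
      have *: "poly p' (inversion (s n)) = c * poly p (s n)" "poly q' (inversion (s n)) = c * poly q (s n)"
        using elim by (simp_all add: p'_def q'_def rev c_def add.commute)
      have "poly q' (inversion (s n)) \<noteq> 0" using \<open>c \<noteq> 0\<close> elim * by simp
      then show ?case using elim g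
        by (simp add: \<phi> regular_Fract * v_mult)
           (cases "v (poly p (s n))"; cases "v (poly q (s n))"; simp)
    qed
    then show "Fraction_Field.Fract p' q' \<in> V_seq R (inversion \<circ> s) \<longleftrightarrow> \<phi> \<in> V_seq R s"
      unfolding V_seq_iff by (auto elim: eventually_elim2)
  qed
qed

section \<open>Both spaces described by the values at \<beta>\<close>

lemma V_conv_eq:
  "V_conv R v \<beta> = {V_seq R s | s. \<forall>n. v (s n - \<beta>) < v (s (Suc n) - \<beta>)}"
proof -
  \<comment> \<open>Increasing values at \<beta> already force pseudo-convergence: in
    \<open>s (Suc n) - s n\<close> the term of smaller value is
    \<open>s n - \<beta>\<close>.\<close>
  have "pseudo_convergent v s" if *: "\<forall>n. v (s n - \<beta>) < v (s (Suc n) - \<beta>)" for s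
  proof -
    have "v (s (Suc n) - s n) = v (s n - \<beta>)" for n
      using v_add_eq[of "s n - \<beta>" "- (s (Suc n) - \<beta>)"] * by (simp add: v_minus_commute)
    then show ?thesis using * by (simp add: pseudo_convergent_def)
  qed
  then show ?thesis
    unfolding V_conv_def pseudo_limits_conv_def by (auto simp: v_minus_commute[of \<beta>])
qed

lemma V_seq_shift: "V_seq R (\<lambda>n. s (n + N)) = V_seq R s"
  unfolding set_eq_iff V_seq_iff
  using eventually_sequentially_seg[of "\<lambda>n. regular \<phi> (s n)" N for \<phi>] by simp

lemma V_div_eq:
  "V_div R v \<beta> = {V_seq R s | s. s 0 \<noteq> \<beta> \<and> (\<forall>n. v (s (Suc n) - \<beta>) < v (s n - \<beta>))}"
proof (intro equalityI subsetI)
  fix W assume "W \<in> V_div R v \<beta>"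
  then obtain s N where s: "W = V_seq R s" "\<And>n. n \<ge> N \<Longrightarrow> v (s (Suc n) - \<beta>) < v (s n - \<beta>)"
    unfolding V_div_def pseudo_limits_div_def by (auto simp: v_minus_commute[of \<beta>])
  \<comment> \<open>\<open>s N\<close> may be \<beta> itself; its successor has a strictly smaller,
    hence finite, value. Dropping the earlier terms does not change the ring.\<close>
  have "s (Suc N) \<noteq> \<beta>" using s(2)[of N] by auto
  moreover have "W = V_seq R (\<lambda>n. s (n + Suc N))" by (simp only: V_seq_shift s)
  ultimately show "W \<in> {V_seq R s | s. s 0 \<noteq> \<beta> \<and> (\<forall>n. v (s (Suc n) - \<beta>) < v (s n - \<beta>))}"
    using s(2) by (intro CollectI exI[of _ "\<lambda>n. s (n + Suc N)"]) simp
next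
  fix W assume "W \<in> {V_seq R s | s. s 0 \<noteq> \<beta> \<and> (\<forall>n. v (s (Suc n) - \<beta>) < v (s n - \<beta>))}"
  then obtain s where s: "W = V_seq R s" "\<And>n. v (s (Suc n) - \<beta>) < v (s n - \<beta>)" by blast
  have "v (s n - s (Suc n)) = v (s (Suc n) - \<beta>)" for n
    using v_add_eq[of "s (Suc n) - \<beta>" "- (s n - \<beta>)"] s(2) by (simp add: v_minus_commute)
  then have "pseudo_divergent v s" using s(2) by (simp add: pseudo_divergent_def)
  then show "W \<in> V_div R v \<beta>"
    using s unfolding V_div_def pseudo_limits_div_def by (auto simp: v_minus_commute[of \<beta>])
qed

text \<open>Inversion negates the values at \<beta>, so strict increase turns into strict
  decrease.\<close>

lemma V_conv_settling:
  assumes "W \<in> V_conv R v \<beta>" obtains s where "W = V_seq R s" "settling s" "V_seq R (inversion \<circ> s) \<in> V_div R v \<beta>"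
proof -
  obtain s where s: "W = V_seq R s" "\<And>n. v (s n - \<beta>) < v (s (Suc n) - \<beta>)"
    using assms unfolding V_conv_eq by blast
  have "s n \<noteq> \<beta>" for n using s(2)[of n] by auto
  then have "V_seq R (inversion \<circ> s) \<in> V_div R v \<beta>"
    unfolding V_div_eq using s(2)
    by (intro CollectI exI[of _ "inversion \<circ> s"]) (simp add: v_inversion, simp add: inversion_def)
  moreover have "settling s" unfolding settling_def using s(2) by (rule settles_increasing)
  ultimately show thesis using that s(1) by blast
qed

lemma V_div_settling:
  assumes "W \<in> V_div R v \<beta>" obtains s where "W = V_seq R s" "settling s" "V_seq R (inversion \<circ> s) \<in> V_conv R v \<beta>"
proof -
  obtain s where s: "W = V_seq R s" "s 0 \<noteq> \<beta>" "\<And>n. v (s (Suc n) - \<beta>) < v (s n - \<beta>)"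
    using assms unfolding V_div_eq by blast
  have "s n \<noteq> \<beta>" for n using s(2) s(3)[of "n - 1"] by (cases n) auto
  then have "V_seq R (inversion \<circ> s) \<in> V_conv R v \<beta>"
    unfolding V_conv_eq using s(3)
    by (intro CollectI exI[of _ "inversion \<circ> s"]) (simp add: v_inversion)
  moreover have "settling s" unfolding settling_def using s(3) by (rule settles_decreasing)
  ultimately show thesis using that s(1) by blast
qed

lemma V_conv_subset_Zar: "V_conv R v \<beta> \<subseteq> Zar R"
  using V_conv_settling V_seq_in_Zar by blast

lemma V_div_subset_Zar: "V_div R v \<beta> \<subseteq> Zar R"
  using V_div_settling V_seq_in_Zar by blast

end

section \<open>Zariski topology on subspaces\<close>

lemma continuous_map_into_Zariski:
  assumes "f ` topspace T \<subseteq> A" "A \<subseteq> Zar V"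
    and "\<And>\<phi>. openin T {x \<in> topspace T. \<phi> \<in> f x}"
  shows "continuous_map T (subtopology (Zariski_topology V) A) f"
proof -
  have "continuous_map T (Zariski_topology V) f"
    unfolding Zariski_topology_def
  proof (rule continuous_on_generated_topo)
    fix U assume "U \<in> {{W \<in> Zar V. \<phi> \<in> W} | \<phi>. True}"
    then obtain \<phi> where U: "U = {W \<in> Zar V. \<phi> \<in> W}" by blast
    have "f -` U \<inter> topspace T = {x \<in> topspace T. \<phi> \<in> f x}" using assms(1,2) U by auto
    then show "openin T (f -` U \<inter> topspace T)" using assms(3) by simp
  next
    \<comment> \<open>The subbasic set of the function 1 is the whole space, so the subbasis covers
      \<open>Zar V\<close>.\<close>
    have "1 \<in> W" if "W \<in> Zar V" for W using that unfolding Zar_def valuation_domain_def by blast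
    then show "f ` topspace T \<subseteq> \<Union> {{W \<in> Zar V. \<phi> \<in> W} | \<phi>. True}" using assms(1,2) by blast
  qed
  then show ?thesis using assms(1) by (simp add: continuous_map_in_subtopology image_subset_iff_funcset)
qed

lemma topspace_Zariski: "topspace (Zariski_topology V) = Zar V"
  unfolding Zariski_topology_def topology_generated_by_topspace
  by (auto simp: Zar_def valuation_domain_def)

lemma openin_Zariski_basic:
  "openin (subtopology (Zariski_topology V) A) {W \<in> A. W \<in> Zar V \<and> \<phi> \<in> W}"
proof -
  have "openin (Zariski_topology V) {W \<in> Zar V. \<phi> \<in> W}"
    unfolding Zariski_topology_def by (rule topology_generated_by_Basis) blast
  then show ?thesis by (auto simp: openin_subtopology)
qed

context centered_valued_field
begin

text \<open>Pulling back along \<open>T\<close> takes the ring of \<open>s\<close> to the ring of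
  the inverted sequence. Inversion is an involution, so the same \<open>f\<close> serves in both
  directions; it is continuous because the preimage of the subbasic set of \<phi> is that of
  \<open>T \<phi>\<close>.\<close>

lemma V_div_homeomorphic_V_conv:
  "subtopology (Zariski_topology R) (V_div R v \<beta>)
     homeomorphic_space subtopology (Zariski_topology R) (V_conv R v \<beta>)"
proof -
  obtain T where T: "\<And>\<phi> s. settling s \<Longrightarrow> T \<phi> \<in> V_seq R (inversion \<circ> s) \<longleftrightarrow> \<phi> \<in> V_seq R s"
  proof -
    have "\<forall>\<phi>. \<exists>\<psi>. \<forall>s. settling s \<longrightarrow> (\<psi> \<in> V_seq R (inversion \<circ> s) \<longleftrightarrow> \<phi> \<in> V_seq R s)"
      using regular_inversion by blast
    from choice[OF this] show thesis using that by blast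
  qed
  define f where "f W = {\<phi>. T \<phi> \<in> W}" for W
  have f: "f (V_seq R (inversion \<circ> s)) = V_seq R s" if "settling s" for s
    using T[OF that] by (auto simp: f_def)
  have f': "f (V_seq R s) = V_seq R (inversion \<circ> s)" if "settling s" for s
    using f[OF settling_inversion[OF that]] by (simp add: comp_def)
  have ts: "topspace (subtopology (Zariski_topology R) A) = A" if "A \<subseteq> Zar R" for A
    using that by (auto simp: topspace_Zariski)
  have div: "f W \<in> V_conv R v \<beta> \<and> f (f W) = W" if "W \<in> V_div R v \<beta>" for W
    using V_div_settling[OF that] f f' by metis
  have conv: "f W \<in> V_div R v \<beta> \<and> f (f W) = W" if "W \<in> V_conv R v \<beta>" for W
    using V_conv_settling[OF that] f f' by metis
  have cont: "continuous_map (subtopology (Zariski_topology R) A) (subtopology (Zariski_topology R) B) f"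
    if "A \<subseteq> Zar R" "B \<subseteq> Zar R" "f ` A \<subseteq> B" for A B
  proof (rule continuous_map_into_Zariski)
    show "f ` topspace (subtopology (Zariski_topology R) A) \<subseteq> B" using that ts by simp
    fix \<phi>
    have "{W \<in> A. \<phi> \<in> f W} = {W \<in> A. W \<in> Zar R \<and> T \<phi> \<in> W}" using that by (auto simp: f_def)
    then show "openin (subtopology (Zariski_topology R) A)
        {x \<in> topspace (subtopology (Zariski_topology R) A). \<phi> \<in> f x}"
      using openin_Zariski_basic[of R A "T \<phi>"] by (simp only: ts[OF that(1)])
  qed (use that in auto)
  show ?thesis
    unfolding homeomorphic_space_def homeomorphic_maps_def
    by (intro exI[of _ f] conjI cont ballI)
      (use div conv ts V_conv_subset_Zar V_div_subset_Zar in auto)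
qed

end

section \<open>Dense value groups\<close>

lemma additive_subgroup_of_int_mult:
  fixes G :: "real set"
  assumes "0 \<in> G" "\<And>a b. a \<in> G \<Longrightarrow> b \<in> G \<Longrightarrow> a - b \<in> G" "g \<in> G"
  shows "of_int n * g \<in> G"
proof -
  have minus: "- a \<in> G" if "a \<in> G" for a using assms(2)[OF assms(1) that] by simp
  have "of_nat m * g \<in> G" for m
  proof (induction m)
    case (Suc m)
    then have "of_nat m * g - (- g) \<in> G" by (intro assms(2) minus assms(3))
    then show ?case by (simp add: algebra_simps)
  qed (use assms(1) in simp)
  then show ?thesis using minus by (cases n rule: int_cases2) force+
qed

text \<open>Without arbitrarily small positive elements, the infimum of the positive elements would
  be attained and generate \<open>G\<close>. Multiples of a small element then hit every
  interval.\<close>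

lemma additive_subgroup_dense:
  fixes G :: "real set"
  assumes G: "0 \<in> G" "\<And>a b. a \<in> G \<Longrightarrow> b \<in> G \<Longrightarrow> a - b \<in> G"
    and not_cyclic: "\<nexists>g. G = {of_int n * g | n. True}" and "x < y"
  shows "\<exists>g\<in>G. x < g \<and> g < y"
proof -
  have mult: "of_int n * g \<in> G" if "g \<in> G" for n g
    by (rule additive_subgroup_of_int_mult[of G]) (fact G that)+
  have small: "\<exists>g\<in>G. 0 < g \<and> g < e" if "e > 0" for e
  proof (rule ccontr)
    assume "\<not> (\<exists>g\<in>G. 0 < g \<and> g < e)"
    then have gap: "e \<le> g" if "g \<in> G" "0 < g" for g using that by (meson not_le)
    define P where "P = {g \<in> G. 0 < g}"
    define m where "m = Inf P"
    have "\<exists>g\<in>G. g \<noteq> 0"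
    proof (rule ccontr)
      assume "\<not> (\<exists>g\<in>G. g \<noteq> 0)"
      then have "G = {of_int n * 0 | n. True}" using G(1) by auto
      then show False using not_cyclic by blast
    qed
    then obtain h where "h \<in> G" "h \<noteq> 0" by blast
    moreover have "- h \<in> G" using mult[OF \<open>h \<in> G\<close>, of "-1"] by simp
    ultimately have "\<bar>h\<bar> \<in> P" by (simp add: P_def abs_if)
    then have "P \<noteq> {}" by blast
    have bdd: "bdd_below P" unfolding P_def by (rule bdd_belowI[of _ 0]) auto
    have "e \<le> m" unfolding m_def by (rule cInf_greatest[OF \<open>P \<noteq> {}\<close>]) (auto simp: P_def gap)
    have "m < m + e" using that by simp
    then obtain g where g: "g \<in> P" "g < m + e"
      unfolding m_def using cInf_less_iff[OF \<open>P \<noteq> {}\<close> bdd] by blast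
    have "m \<le> g" unfolding m_def by (rule cInf_lower[OF g(1) bdd])
    \<comment> \<open>An element of \<open>P\<close> below \<open>g\<close> would differ from it by
      less than \<open>e\<close>, against the gap.\<close>
    have "g = m"
    proof (rule ccontr)
      assume "g \<noteq> m"
      then have "m < g" using \<open>m \<le> g\<close> by simp
      then obtain g' where g': "g' \<in> P" "g' < g"
        using cInf_less_iff[OF \<open>P \<noteq> {}\<close> bdd] unfolding m_def by blast
      have "m \<le> g'" unfolding m_def by (rule cInf_lower[OF g'(1) bdd])
      moreover have "g - g' \<in> G" using g g' G(2) unfolding P_def by blast
      ultimately show False using gap[of "g - g'"] g g' by simp
    qed
    then have "m \<in> G" "0 < m" using g(1) by (auto simp: P_def)
    \<comment> \<open>Division with remainder: a remainder in \<open>G\<close> below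
      \<open>m\<close> is 0.\<close>
    have "G = {of_int n * m | n. True}"
    proof (intro equalityI subsetI)
      fix a assume "a \<in> G"
      define n where "n = \<lfloor>a / m\<rfloor>"
      have "of_int n \<le> a / m" "a / m < of_int n + 1" unfolding n_def by linarith+
      then have *: "of_int n * m \<le> a" "a < of_int n * m + m"
        using \<open>0 < m\<close> by (simp_all add: field_simps)
      have "a - of_int n * m \<in> G" by (rule G(2)[OF \<open>a \<in> G\<close> mult[OF \<open>m \<in> G\<close>]])
      moreover have "m \<le> b" if "b \<in> G" "0 < b" for b
        unfolding m_def by (rule cInf_lower[OF _ bdd]) (use that in \<open>simp add: P_def\<close>)
      ultimately have "a - of_int n * m = 0" using * by fastforce
      then show "a \<in> {of_int n * m | n. True}" by auto
    qed (use mult[OF \<open>m \<in> G\<close>] in auto)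
    then show False using not_cyclic by blast
  qed
  obtain g where g: "g \<in> G" "0 < g" "g < y - x" using small[of "y - x"] \<open>x < y\<close> by auto
  \<comment> \<open>The least integer with \<open>n * g\<close> beyond \<open>x\<close>; the
    overshoot is at most \<open>g < y - x\<close>.\<close>
  define n where "n = \<lfloor>x / g\<rfloor> + 1"
  have "x / g < of_int n" "of_int n \<le> x / g + 1" unfolding n_def by linarith+
  then have "x < of_int n * g" "of_int n * g \<le> x + g" using g(2) by (simp_all add: field_simps)
  then show ?thesis using mult[OF g(1), of n] g(3) by (intro bexI[of _ "of_int n * g"]) auto
qed

lemma strictly_increasing_reals_to:
  fixes \<delta> :: ereal assumes "-\<infinity> < \<delta>"
  obtains f :: "nat \<Rightarrow> real" where "\<And>n. f n < f (Suc n)" "\<And>n. ereal (f n) < \<delta>"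
    "\<And>a. a < \<delta> \<Longrightarrow> \<exists>n. a < ereal (f n)"
proof (cases \<delta>)
  case (real d)
  show thesis
  proof (rule that[of "\<lambda>n. d - inverse (real (Suc n))"])
    fix a assume "a < \<delta>"
    show "\<exists>n. a < ereal (d - inverse (real (Suc n)))"
    proof (cases a)
      case (real r)
      with \<open>a < \<delta>\<close> \<open>\<delta> = ereal d\<close> have "0 < d - r" by simp
      from reals_Archimedean[OF this] obtain n where "inverse (real (Suc n)) < d - r" by blast
      with real show ?thesis by (intro exI[of _ n]) simp
    qed (use \<open>a < \<delta>\<close> real in auto)
  qed (simp_all add: real field_simps)
next
  case PInf
  show thesis
  proof (rule that[of real])
    fix a assume "a < \<delta>"
    then show "\<exists>n. a < ereal (real n)"
      using PInf by (cases a) (auto intro: reals_Archimedean2)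
  qed (simp_all add: PInf)
qed (use assms in simp)

section \<open>Rings parametrized by a left limit\<close>

locale dense_valued_field = centered_valued_field v \<beta> for v :: "'k::field \<Rightarrow> ereal" and \<beta> +
  assumes dense: "x < y \<Longrightarrow> \<exists>g\<in>value_group v. x < g \<and> g < y"
begin

lemma dense_ereal:
  assumes "a < b" obtains s where "a < v (s - \<beta>)" "v (s - \<beta>) < b"
proof -
  obtain x where x: "a < ereal x" "ereal x < b" using ereal_dense2[OF assms] by blast
  obtain y where y: "x < y" "ereal y < b" using ereal_dense2[OF x(2)] by auto
  obtain g where g: "x < g" "g < y" "g \<in> value_group v" using dense[OF y(1)] by blast
  then obtain z where z: "v z = ereal g" by (auto simp: value_group_def)
  show thesis
  proof (rule that[of "z + \<beta>"])
    show "a < v (z + \<beta> - \<beta>)" using less_trans[OF x(1), of "ereal g"] g(1) z by simp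
    show "v (z + \<beta> - \<beta>) < b" using less_trans[OF _ y(2), of "ereal g"] g(2) z by simp
  qed
qed

text \<open>Regularity on an annulus around \<beta> whose values lie just below \<delta>, a
  punctured disc for \<open>\<delta> = \<infinity>\<close>. Quantifying over all points leaves
  \<delta> as the only parameter; for \<open>\<delta> > -\<infinity>\<close> density keeps these
  annuli nonempty.\<close>

definition left_limit_ring :: "ereal \<Rightarrow> 'k poly fract set" where
  "left_limit_ring \<delta> = {\<phi>. \<exists>\<alpha><\<delta>. \<forall>s. \<alpha> < v (s - \<beta>) \<longrightarrow> v (s - \<beta>) < \<delta> \<longrightarrow> regular \<phi> s}"

text \<open>\<open>c\<close> is the least breakpoint of \<open>\<phi>\<close> that is \<open>\<ge> \<delta>\<close>, so \<open>{a<..c}\<close> is a basic open set.\<close>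

lemma regular_near:
  assumes "-\<infinity> < \<delta>"
  obtains a c where "-\<infinity> < a" "a < \<delta>" "\<delta> \<le> c" "c \<in> ereal ` rational_span_value_group v \<union> {\<infinity>}"
    "\<forall>s t. v (s - \<beta>) \<in> {a<..<c} \<longrightarrow> v (t - \<beta>) \<in> {a<..<c} \<longrightarrow> regular \<phi> s = regular \<phi> t"
proof -
  obtain B where B: "finite B" "B \<subseteq> rational_span_value_group v"
    "\<And>s t x y. v (s - \<beta>) = ereal x \<Longrightarrow> v (t - \<beta>) = ereal y \<Longrightarrow> same_side B x y \<Longrightarrow>
        regular \<phi> s = regular \<phi> t"
    using regular_same_side[of \<beta> \<phi>] by blast
  \<comment> \<open>The infinite elements are defaults that make \<open>Max D\<close> and
    \<open>Min C\<close> exist. A real \<open>a\<close> strictly between \<open>Max D\<close> and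
    \<delta> exceeds \<open>-\<infinity>\<close>, as a basic open set demands.\<close>
  define D where "D = insert (-\<infinity>) {ereal b | b. b \<in> B \<and> ereal b < \<delta>}"
  define C where "C = insert \<infinity> {ereal b | b. b \<in> B \<and> \<delta> \<le> ereal b}"
  have fin: "finite D" "finite C" using B(1) by (simp_all add: D_def C_def)
  have ne: "D \<noteq> {}" "C \<noteq> {}" by (simp_all add: D_def C_def)
  have "Max D < \<delta>" using fin ne assms by (auto simp: D_def)
  then obtain a where a: "Max D < ereal a" "ereal a < \<delta>" using ereal_dense2 by blast
  have c: "Min C \<in> C" using fin ne by simp
  show thesis
  proof (rule that[of "ereal a" "Min C"])
    show "\<delta> \<le> Min C" using c by (auto simp: C_def)
    show "Min C \<in> ereal ` rational_span_value_group v \<union> {\<infinity>}" using c B(2) by (auto simp: C_def)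
    have "regular \<phi> s = regular \<phi> t" if "v (s - \<beta>) \<in> {ereal a<..<Min C}" "v (t - \<beta>) \<in> {ereal a<..<Min C}" for s t
    proof -
      have st: "ereal a < v (s - \<beta>)" "v (s - \<beta>) < Min C" "ereal a < v (t - \<beta>)" "v (t - \<beta>) < Min C"
        using that by simp_all
      obtain x where x: "v (s - \<beta>) = ereal x" using st by (cases "v (s - \<beta>)") auto
      obtain y where y: "v (t - \<beta>) = ereal y" using st by (cases "v (t - \<beta>)") auto
      have "same_side B x y"
        unfolding same_side_def
      proof
        fix b assume "b \<in> B"
        show "x < b \<and> y < b \<or> b < x \<and> b < y"
        proof (cases "ereal b < \<delta>")
          case True
          then have "ereal b \<in> D" using \<open>b \<in> B\<close> by (auto simp: D_def)
          then have "ereal b < ereal a" using a(1) fin by (meson Max_ge le_less_trans)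
          then have "ereal b < ereal x" "ereal b < ereal y"
            using less_trans[OF _ st(1), of "ereal b"] less_trans[OF _ st(3), of "ereal b"] x y by simp_all
          then show ?thesis by simp
        next
          case False
          then have "ereal b \<in> C" using \<open>b \<in> B\<close> by (auto simp: C_def)
          then have "Min C \<le> ereal b" using fin by simp
          then have "ereal x < ereal b" "ereal y < ereal b"
            using less_le_trans[OF st(2), of "ereal b"] less_le_trans[OF st(4), of "ereal b"] x y by simp_all
          then show ?thesis by simp
        qed
      qed
      then show ?thesis using B(3) x y by blast
    qed
    then show "\<forall>s t. v (s - \<beta>) \<in> {ereal a<..<Min C} \<longrightarrow> v (t - \<beta>) \<in> {ereal a<..<Min C} \<longrightarrow>
        regular \<phi> s = regular \<phi> t" by blast
  qed (use a in auto)
qed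

text \<open>One late regular term lies where regularity is constant and so decides a whole left
  neighbourhood of \<delta>. Conversely, the sequence enters each such neighbourhood and stays
  there.\<close>

lemma V_seq_eq_left_limit_ring:
  assumes inc: "\<And>n. v (s n - \<beta>) < v (s (Suc n) - \<beta>)"
    and less: "\<And>n. v (s n - \<beta>) < \<delta>" and lim: "\<And>a. a < \<delta> \<Longrightarrow> \<exists>n. a < v (s n - \<beta>)"
  shows "V_seq R s = left_limit_ring \<delta>"
proof -
  have mono: "v (s m - \<beta>) \<le> v (s n - \<beta>)" if "m \<le> n" for m n
    using that by (rule lift_Suc_mono_le[rotated]) (rule less_imp_le[OF inc])
  have ev: "\<forall>\<^sub>F n in sequentially. a < v (s n - \<beta>)" if a: "a < \<delta>" for a
  proof -
    obtain N where "a < v (s N - \<beta>)" using lim[OF a] by blast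
    then have "a < v (s n - \<beta>)" if "N \<le> n" for n using mono[OF that] by (rule less_le_trans)
    then show ?thesis unfolding eventually_sequentially by blast
  qed
  have "-\<infinity> < \<delta>" using less[of 0] by auto
  show ?thesis
  proof (intro equalityI subsetI)
    fix \<phi> assume \<phi>: "\<phi> \<in> V_seq R s"
    from \<open>-\<infinity> < \<delta>\<close> obtain a c where "-\<infinity> < a" and ac: "a < \<delta>" "\<delta> \<le> c"
      "c \<in> ereal ` rational_span_value_group v \<union> {\<infinity>}" 
      "\<forall>s t. v (s - \<beta>) \<in> {a<..<c} \<longrightarrow> v (t - \<beta>) \<in> {a<..<c} \<longrightarrow> regular \<phi> s = regular \<phi> t"
      by (rule regular_near)
    have "\<forall>\<^sub>F n in sequentially. regular \<phi> (s n) \<and> a < v (s n - \<beta>)"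
      using \<phi> ev[OF ac(1)] unfolding V_seq_iff by (rule eventually_conj)
    then obtain n where n: "regular \<phi> (s n)" "a < v (s n - \<beta>)"
      using eventually_happens[of _ sequentially] by auto
    have "regular \<phi> t" if "a < v (t - \<beta>)" "v (t - \<beta>) < \<delta>" for t
      using ac(4)[rule_format, of "s n" t] n that
        less_le_trans[OF less[of n] ac(2)] less_le_trans[OF that(2) ac(2)] by simp
    then show "\<phi> \<in> left_limit_ring \<delta>" using ac(1) by (auto simp: left_limit_ring_def)
  next
    fix \<phi> assume "\<phi> \<in> left_limit_ring \<delta>"
    then obtain a where a: "a < \<delta>" "\<And>t. a < v (t - \<beta>) \<Longrightarrow> v (t - \<beta>) < \<delta> \<Longrightarrow> regular \<phi> t"
      by (auto simp: left_limit_ring_def)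
    from ev[OF a(1)] show "\<phi> \<in> V_seq R s"
      unfolding V_seq_iff by eventually_elim (use a less in auto)
  qed
qed

lemma V_conv_eq_left_limit_rings: "V_conv R v \<beta> = left_limit_ring ` {-\<infinity><..}"
proof (intro equalityI subsetI)
  fix W assume "W \<in> V_conv R v \<beta>"
  then obtain s where s: "W = V_seq R s" "\<And>n. v (s n - \<beta>) < v (s (Suc n) - \<beta>)"
    unfolding V_conv_eq by blast
  \<comment> \<open>The supremum is not attained, since the values increase strictly.\<close>
  define \<delta> where "\<delta> = (SUP n. v (s n - \<beta>))"
  have less: "v (s n - \<beta>) < \<delta>" for n
    unfolding \<delta>_def by (rule less_le_trans[OF s(2)]) (rule SUP_upper, simp)
  have "W = left_limit_ring \<delta>"
    unfolding s(1)
  proof (rule V_seq_eq_left_limit_ring)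
    fix a assume "a < \<delta>"
    then show "\<exists>n. a < v (s n - \<beta>)" by (simp add: \<delta>_def less_SUP_iff)
  qed (fact s(2) less)+
  moreover have "-\<infinity> < \<delta>" using less[of 0] by auto
  ultimately show "W \<in> left_limit_ring ` {-\<infinity><..}" by auto
next
  fix W assume "W \<in> left_limit_ring ` {-\<infinity><..}"
  then obtain \<delta> where \<delta>: "W = left_limit_ring \<delta>" "-\<infinity> < \<delta>" by auto
  from \<delta>(2) obtain f where f: "\<And>n. f n < f (Suc n)" "\<And>n. ereal (f n) < \<delta>"
    "\<And>a. a < \<delta> \<Longrightarrow> \<exists>n. a < ereal (f n)"
    by (rule strictly_increasing_reals_to) blast
  \<comment> \<open>Values interlaced with \<open>f\<close> increase strictly and have the same
    limit \<delta>.\<close>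
  have "\<exists>s. ereal (f n) < v (s - \<beta>) \<and> v (s - \<beta>) < ereal (f (Suc n))" for n
      proof -
    have "ereal (f n) < ereal (f (Suc n))" using f(1) by simp
    then show ?thesis by (rule dense_ereal) blast
  qed
  then have "\<exists>s. \<forall>n. ereal (f n) < v (s n - \<beta>) \<and> v (s n - \<beta>) < ereal (f (Suc n))"
    by (intro choice allI)
  then obtain s where s: "\<And>n. ereal (f n) < v (s n - \<beta>)" "\<And>n. v (s n - \<beta>) < ereal (f (Suc n))"
    by blast
  have inc: "v (s n - \<beta>) < v (s (Suc n) - \<beta>)" for n using s(2)[of n] s(1)[of "Suc n"] by (rule less_trans)
  have "V_seq R s = left_limit_ring \<delta>"
  proof (rule V_seq_eq_left_limit_ring)
    show "v (s n - \<beta>) < \<delta>" for n by (rule less_trans[OF s(2) f(2)])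
    show "\<exists>n. a < v (s n - \<beta>)" if "a < \<delta>" for a using f(3)[OF that] s(1) less_trans by blast
  qed (fact inc)
  then show "W \<in> V_conv R v \<beta>" unfolding V_conv_eq using inc \<delta>(1) by auto
qed

text \<open>The quotient is regular exactly where the value at \<beta> is at least \<open>g\<close>.
  For \<open>\<delta> = ereal g\<close> all points of the annuli have smaller value, hence the
  strict bound.\<close>

lemma linear_mem_left_limit_ring:
  assumes "v c = ereal g"
  shows "Fraction_Field.Fract [:-\<beta>, 1:] [:c:] \<in> left_limit_ring \<delta> \<longleftrightarrow> ereal g < \<delta>"
proof -
  have "c \<noteq> 0" using assms by auto
  then have reg: "regular (Fraction_Field.Fract [:-\<beta>, 1:] [:c:]) s \<longleftrightarrow> ereal g \<le> v (s - \<beta>)" for s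
    by (simp add: regular_Fract assms)
  show ?thesis
  proof
    assume "Fraction_Field.Fract [:-\<beta>, 1:] [:c:] \<in> left_limit_ring \<delta>"
    then obtain a where a: "a < \<delta>" "\<And>s. a < v (s - \<beta>) \<Longrightarrow> v (s - \<beta>) < \<delta> \<Longrightarrow>
        regular (Fraction_Field.Fract [:-\<beta>, 1:] [:c:]) s"
      unfolding left_limit_ring_def by blast
    from a(1) obtain s where "a < v (s - \<beta>)" "v (s - \<beta>) < \<delta>" by (rule dense_ereal)
    then show "ereal g < \<delta>" using a(2)[of s] reg[of s] by (meson le_less_trans)
  qed (auto simp: left_limit_ring_def reg)
qed

lemma power_mem_left_limit_ring:
  assumes "v c = ereal g" "k > 0" "-\<infinity> < \<delta>"
  shows "Fraction_Field.Fract [:c:] ([:-\<beta>, 1:] ^ k) \<in> left_limit_ring \<delta> \<longleftrightarrow> \<delta> \<le> ereal (g / real k)"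
proof -
  have reg: "regular (Fraction_Field.Fract [:c:] ([:-\<beta>, 1:] ^ k)) s \<longleftrightarrow> v (s - \<beta>) \<le> ereal (g / real k)"
    if "v (s - \<beta>) < \<delta>" for s
  proof -
    have "s \<noteq> \<beta>" using that by auto
    then obtain x where x: "v (s - \<beta>) = ereal x" using v_realE[of "s - \<beta>"] by auto
    have "regular (Fraction_Field.Fract [:c:] ([:-\<beta>, 1:] ^ k)) s \<longleftrightarrow> v ((s - \<beta>) ^ k) \<le> v c"
      using \<open>s \<noteq> \<beta>\<close> by (simp add: regular_Fract)
    also have "\<dots> \<longleftrightarrow> v (s - \<beta>) \<le> ereal (g / real k)"
      using assms(1,2) by (simp add: v_power[OF x] x field_simps)
    finally show ?thesis .
  qed
  show ?thesis
  proof
    assume "Fraction_Field.Fract [:c:] ([:-\<beta>, 1:] ^ k) \<in> left_limit_ring \<delta>"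
    then obtain a where a: "a < \<delta>" "\<And>s. a < v (s - \<beta>) \<Longrightarrow> v (s - \<beta>) < \<delta> \<Longrightarrow>
        regular (Fraction_Field.Fract [:c:] ([:-\<beta>, 1:] ^ k)) s"
      unfolding left_limit_ring_def by blast
    show "\<delta> \<le> ereal (g / real k)"
    proof (rule ccontr)
      assume "\<not> \<delta> \<le> ereal (g / real k)"
      then have "max a (ereal (g / real k)) < \<delta>" using a(1) by simp
      then obtain s where s: "max a (ereal (g / real k)) < v (s - \<beta>)" "v (s - \<beta>) < \<delta>" by (rule dense_ereal)
      then have "a < v (s - \<beta>)" "ereal (g / real k) < v (s - \<beta>)" by auto
      then show False using a(2)[of s] reg[of s] s(2) by simp
    qed
  next
    assume "\<delta> \<le> ereal (g / real k)"
    then show "Fraction_Field.Fract [:c:] ([:-\<beta>, 1:] ^ k) \<in> left_limit_ring \<delta>"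
      unfolding left_limit_ring_def using assms(3) reg by (auto intro!: exI[of _ "-\<infinity>"])
  qed
qed

text \<open>By density some value lies strictly between the two parameters, and the linear quotient
  for it separates the rings.\<close>

lemma inj_left_limit_ring: "inj_on left_limit_ring {-\<infinity><..}"
proof (rule linorder_inj_onI)
  fix x y :: ereal assume "x < y"
  then obtain s where s: "x < v (s - \<beta>)" "v (s - \<beta>) < y" by (rule dense_ereal)
  then obtain g where "v (s - \<beta>) = ereal g" by (cases "v (s - \<beta>)") auto
  then show "left_limit_ring x \<noteq> left_limit_ring y"
    using linear_mem_left_limit_ring[of "s - \<beta>" g x] linear_mem_left_limit_ring[of "s - \<beta>" g y] s by auto
qed auto

section \<open>Comparison with the half-open line\<close>

lemma topspace_upper_line: "topspace (upper_line_topology L) = {-\<infinity><..}"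
proof -
  have "x \<in> \<Union> {{\<alpha><..l} | \<alpha> l. -\<infinity> < \<alpha> \<and> l \<in> ereal ` L \<union> {\<infinity>}}" if x: "-\<infinity> < x" for x :: ereal
  proof -
    obtain a where "-\<infinity> < ereal a" "ereal a < x" using ereal_dense2[OF x] by blast
    then have "x \<in> {ereal a<..\<infinity>}" "-\<infinity> < ereal a" by simp_all
    then show ?thesis by blast
  qed
  moreover have "-\<infinity> < x" if "x \<in> \<Union> {{\<alpha><..l} | \<alpha> l. -\<infinity> < \<alpha> \<and> l \<in> ereal ` L \<union> {\<infinity>}}" for x :: ereal
    using that by auto
  ultimately show ?thesis
    unfolding upper_line_topology_def topology_generated_by_topspace by blast
qed

lemma continuous_left_limit_ring:
  "continuous_map (upper_line_topology (rational_span_value_group v))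
     (subtopology (Zariski_topology R) (V_conv R v \<beta>)) left_limit_ring"
proof (rule continuous_map_into_Zariski)
  show "left_limit_ring ` topspace (upper_line_topology (rational_span_value_group v)) \<subseteq> V_conv R v \<beta>"
    by (simp add: topspace_upper_line V_conv_eq_left_limit_rings)
  fix \<phi>
  let ?S = "{\<delta> \<in> {-\<infinity><..}. \<phi> \<in> left_limit_ring \<delta>}"
  have "\<exists>T. openin (upper_line_topology (rational_span_value_group v)) T \<and> \<delta> \<in> T \<and> T \<subseteq> ?S"
    if \<delta>: "\<delta> \<in> ?S" for \<delta>
  proof -
    have "-\<infinity> < \<delta>" using \<delta> by simp
    then obtain a c where ac: "-\<infinity> < a" "a < \<delta>" "\<delta> \<le> c" "c \<in> ereal ` rational_span_value_group v \<union> {\<infinity>}"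
      "\<forall>s t. v (s - \<beta>) \<in> {a<..<c} \<longrightarrow> v (t - \<beta>) \<in> {a<..<c} \<longrightarrow> regular \<phi> s = regular \<phi> t"
      by (rule regular_near)
    obtain a' where a': "a' < \<delta>" "\<And>s. a' < v (s - \<beta>) \<Longrightarrow> v (s - \<beta>) < \<delta> \<Longrightarrow> regular \<phi> s"
      using \<delta> by (auto simp: left_limit_ring_def)
    have "max a a' < \<delta>" using ac(2) a'(1) by simp
    \<comment> \<open>\<open>t\<close> lies both where \<phi> is regular and where regularity is
      constant, so regularity spreads to all values between \<open>a\<close> and \<open>c\<close>,
      possibly beyond \<delta>.\<close>
    then obtain t where t: "max a a' < v (t - \<beta>)" "v (t - \<beta>) < \<delta>" by (rule dense_ereal)
    have "regular \<phi> s" if "a < v (s - \<beta>)" "v (s - \<beta>) < c" for s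
      using ac(5)[rule_format, of s t] that t a'(2)[of t] less_le_trans[OF t(2) ac(3)] by simp
    then have "\<phi> \<in> left_limit_ring \<delta>'" if "\<delta>' \<in> {a<..c}" for \<delta>'
      using that unfolding left_limit_ring_def by (auto intro!: exI[of _ a])
    then have "{a<..c} \<subseteq> ?S" using ac(1) by auto
    moreover have "openin (upper_line_topology (rational_span_value_group v)) {a<..c}"
      unfolding upper_line_topology_def by (rule topology_generated_by_Basis) (use ac in blast)
    ultimately show ?thesis using ac(2,3) by auto
  qed
  then have "openin (upper_line_topology (rational_span_value_group v)) ?S"
    by (subst openin_subopen) blast
  then show "openin (upper_line_topology (rational_span_value_group v))
      {x \<in> topspace (upper_line_topology (rational_span_value_group v)). \<phi> \<in> left_limit_ring x}"
    by (simp add: topspace_upper_line)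
qed (rule V_conv_subset_Zar)

text \<open>For a rational factor \<open>m / k\<close>, the integer \<open>m\<close> is absorbed
  into the value group and \<open>k\<close> becomes the exponent of
  \<open>power_mem_left_limit_ring\<close>.\<close>

lemma rational_span_value_groupE:
  assumes "l \<in> rational_span_value_group v"
  obtains c g k where "v c = ereal g" "k > 0" "l = g / real k"
proof -
  obtain q h where q: "l = of_rat q * h" "h \<in> value_group v"
    using assms by (auto simp: rational_span_value_group_def)
  obtain m k where mk: "quotient_of q = (m, k)" by force
  have k: "k > 0" using quotient_of_denom_pos[OF mk] .
  have "of_int m * h \<in> value_group v"
    by (rule additive_subgroup_of_int_mult) (use q(2) value_group_zero value_group_diff in auto)
  then obtain c where "v c = ereal (of_int m * h)" by (auto simp: value_group_def)
  moreover have "l = of_int m * h / real (nat k)"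
    using q(1) k by (simp add: quotient_of_div[OF mk] of_rat_divide)
  ultimately show thesis using that[of c "of_int m * h" "nat k"] k by simp
qed

text \<open>The upper end is cut out by one open set \<open>U\<close>. The lower end
  \<open>a\<close> need not be a value, so each point gets its own cut at a value above
  \<open>a\<close>.\<close>

lemma openin_left_limit_ring_image:
  assumes "-\<infinity> < a" "l \<in> ereal ` rational_span_value_group v \<union> {\<infinity>}"
  shows "openin (subtopology (Zariski_topology R) (V_conv R v \<beta>)) (left_limit_ring ` {a<..l})"
    (is "openin ?Z _")
proof -
  have basic: "openin ?Z {W \<in> V_conv R v \<beta>. \<phi> \<in> W}" for \<phi>
  proof -
    have "{W \<in> V_conv R v \<beta>. \<phi> \<in> W} = {W \<in> V_conv R v \<beta>. W \<in> Zar R \<and> \<phi> \<in> W}"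
      using V_conv_subset_Zar by blast
    then show ?thesis using openin_Zariski_basic by simp
  qed
  have upper: "\<exists>U. openin ?Z U \<and> (\<forall>\<delta>>-\<infinity>. left_limit_ring \<delta> \<in> U \<longleftrightarrow> \<delta> \<le> l)"
  proof (cases "l = \<infinity>")
    case True
    then show ?thesis
      using V_conv_eq_left_limit_rings V_conv_subset_Zar
      by (intro exI[of _ "V_conv R v \<beta>"]) (auto simp: openin_subtopology_refl topspace_Zariski)
  next
    case False
    then obtain c g k where "v c = ereal g" "k > 0" "l = ereal (g / real k)"
      using assms(2) by (auto elim: rational_span_value_groupE)
    then show ?thesis
      using basic[of "Fraction_Field.Fract [:c:] ([:-\<beta>, 1:] ^ k)"] V_conv_eq_left_limit_rings
      by (intro exI[of _ "{W \<in> V_conv R v \<beta>. Fraction_Field.Fract [:c:] ([:-\<beta>, 1:] ^ k) \<in> W}"])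
        (auto simp: power_mem_left_limit_ring)
  qed
  then obtain U where U: "openin ?Z U" "\<And>\<delta>. -\<infinity> < \<delta> \<Longrightarrow> left_limit_ring \<delta> \<in> U \<longleftrightarrow> \<delta> \<le> l" by blast
  show ?thesis
  proof (subst openin_subopen, intro ballI)
    fix W assume "W \<in> left_limit_ring ` {a<..l}"
    then obtain \<delta> where \<delta>: "W = left_limit_ring \<delta>" "a < \<delta>" "\<delta> \<le> l" by auto
    from \<delta>(2) obtain s where s: "a < v (s - \<beta>)" "v (s - \<beta>) < \<delta>" by (rule dense_ereal)
    then obtain g where g: "v (s - \<beta>) = ereal g" by (cases "v (s - \<beta>)") auto
    \<comment> \<open>Corresponds to the parameters in \<open>{ereal g<..l}\<close>, which contains
      \<delta> and lies in \<open>{a<..l}\<close>.\<close>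
    let ?T = "U \<inter> {W \<in> V_conv R v \<beta>. Fraction_Field.Fract [:-\<beta>, 1:] [:s - \<beta>:] \<in> W}"
    have mem: "left_limit_ring x \<in> ?T \<longleftrightarrow> ereal g < x \<and> x \<le> l" if "-\<infinity> < x" for x
      using that U(2) by (auto simp: V_conv_eq_left_limit_rings linear_mem_left_limit_ring[OF g])
    have "openin ?Z ?T" using U(1) basic by blast
    moreover have "-\<infinity> < \<delta>" using assms(1) \<delta>(2) by (rule less_trans)
    then have "W \<in> ?T" using \<delta> mem s g by simp
    moreover have "?T \<subseteq> left_limit_ring ` {a<..l}"
    proof
      fix X assume X: "X \<in> ?T"
      then obtain x where x: "X = left_limit_ring x" "-\<infinity> < x" by (auto simp: V_conv_eq_left_limit_rings)
      then have "ereal g < x" "x \<le> l" using X mem by simp_all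
      then show "X \<in> left_limit_ring ` {a<..l}" using less_trans[OF s(1)] g x(1) by auto
    qed
    ultimately show "\<exists>T. openin ?Z T \<and> W \<in> T \<and> T \<subseteq> left_limit_ring ` {a<..l}" by blast
  qed
qed

lemma V_conv_homeomorphic_upper_line:
  "subtopology (Zariski_topology R) (V_conv R v \<beta>)
     homeomorphic_space upper_line_topology (rational_span_value_group v)"
proof -
  let ?Z = "subtopology (Zariski_topology R) (V_conv R v \<beta>)"
  let ?L = "upper_line_topology (rational_span_value_group v)"
  define h where "h = inv_into {-\<infinity><..} left_limit_ring"
  have ts: "topspace ?Z = left_limit_ring ` {-\<infinity><..}"
    using V_conv_subset_Zar by (auto simp: topspace_Zariski V_conv_eq_left_limit_rings)
  have h: "h (left_limit_ring \<delta>) = \<delta>" if "-\<infinity> < \<delta>" for \<delta>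
    unfolding h_def using inj_left_limit_ring that by (simp add: inv_into_f_f)
  have "continuous_map ?Z ?L h"
    unfolding upper_line_topology_def
  proof (rule continuous_on_generated_topo)
    fix U assume "U \<in> {{\<alpha><..l} | \<alpha> l. -\<infinity> < \<alpha> \<and> l \<in> ereal ` rational_span_value_group v \<union> {\<infinity>}}"
    then obtain a l where U: "U = {a<..l}" "-\<infinity> < a" "l \<in> ereal ` rational_span_value_group v \<union> {\<infinity>}"
      by blast
    have "x > -\<infinity>" if "x \<in> U" for x using that U(1,2) by auto
    then have "h -` U \<inter> topspace ?Z = left_limit_ring ` U"
      unfolding ts using h by force
    then show "openin ?Z (h -` U \<inter> topspace ?Z)" using openin_left_limit_ring_image U by simp
  next
    show "h ` topspace ?Z \<subseteq> \<Union> {{\<alpha><..l} | \<alpha> l. -\<infinity> < \<alpha> \<and> l \<in> ereal ` rational_span_value_group v \<union> {\<infinity>}}"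
      using topspace_upper_line[of "rational_span_value_group v"] h
      unfolding upper_line_topology_def topology_generated_by_topspace ts by auto
  qed
  then have "homeomorphic_maps ?Z ?L h left_limit_ring"
    unfolding homeomorphic_maps_def
  proof (intro conjI ballI continuous_left_limit_ring)
    show "left_limit_ring (h W) = W" if "W \<in> topspace ?Z" for W using that h unfolding ts by auto
    show "h (left_limit_ring \<delta>) = \<delta>" if "\<delta> \<in> topspace ?L" for \<delta>
      using that h by (simp add: topspace_upper_line)
  qed
  then show ?thesis unfolding homeomorphic_space_def by blast
qed

end

theorem proposition5p5:
  fixes V :: "'k::field set" and v :: "'k \<Rightarrow> ereal" and \<beta> :: 'k
  assumes "valuation_domain V" and "rank_one V" and "associated_valuation V v"
  shows "subtopology (Zariski_topology V) (V_div V v \<beta>)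
           homeomorphic_space subtopology (Zariski_topology V) (V_conv V v \<beta>) \<and>
         (\<not> discrete_valuation v \<longrightarrow>
            subtopology (Zariski_topology V) (V_conv V v \<beta>)
              homeomorphic_space upper_line_topology (rational_span_value_group v))"
proof -
  interpret centered_valued_field v \<beta>
    by unfold_locales (use assms(3) in \<open>simp add: associated_valuation_def\<close>)
  have V: "V = R" using assms(3) by (simp add: associated_valuation_def)
  have "subtopology (Zariski_topology R) (V_conv R v \<beta>)
      homeomorphic_space upper_line_topology (rational_span_value_group v)" if "\<not> discrete_valuation v"
  proof -
    \<comment> \<open>A non-discrete valuation has a non-cyclic value group, and such a subgroup of
      the reals is dense.\<close>
    interpret dense_valued_field v \<beta>
    proof
      fix x y :: real assume "x < y"
      then show "\<exists>g\<in>value_group v. x < g \<and> g < y"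
        using that unfolding discrete_valuation_def
        by (intro additive_subgroup_dense value_group_zero value_group_diff)
    qed
    show ?thesis by (rule V_conv_homeomorphic_upper_line)
  qed
  then show ?thesis unfolding V using V_div_homeomorphic_V_conv by blast
qed

end
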